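(* Let $x\in[0,1]$ and let $b,n,s$ be nonnegative integers with $n\ge bs$. Then $$\mathfrak{S}_{n}(bs,x)=2^{b(1-s)}x^{bs}\sum_{j=0}^{n}\binom{n}{j}S(j,bs)\,B_{n-j}^{(bs)}(1-x).$$
   Context: For nonnegative integers $b,s$ and $x\in[0,1]$, the polynomials $\mathfrak{S}_n(bs,x)$ ($n\ge 0$) are defined by the generating function $$\frac{2^{b}x^{bs}\left(\frac{t}{2}\right)^{bs}e^{t(1-x)}}{(bs)!}=\sum_{n=0}^{\infty}\mathfrak{S}_{n}(bs,x)\frac{t^{n}}{n!},\qquad t\in\mathbb{C}$$ (they depend on the pair $(b,s)$, not only on the product $bs$; convention $0^0=1$). For a nonnegative integer $v$, the Bernoulli polynomials of higher order $B_n^{(v)}(x)$ are defined by $$\frac{t^{v}e^{xt}}{(e^{t}-1)^{v}}=\sum_{n=0}^{\infty}B_{n}^{(v)}(x)\frac{t^{n}}{n!},\qquad |t|<2\pi,$$ and the Stirling numbers of the second kind $S(n,v)$ by $$(-1)^{v}\frac{(1-e^{t})^{v}}{v!}=\sum_{n=0}^{\infty}S(n,v)\frac{t^{n}}{n!}.$$ *)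

theory Defs
  imports
    "HOL-Combinatorics.Stirling"
    "HOL-Complex_Analysis.Complex_Analysis"
begin

text \<open>
  The generating functions are read as formal power series in \<open>t = fps_X\<close>; the lemmas
  \<open>frakS_sums\<close>, \<open>bernoulli_higher_sums\<close> and \<open>Stirling_sums\<close> below give the corresponding
  convergent expansions for complex \<open>t\<close>.
\<close>

definition frakS_fps :: "nat \<Rightarrow> nat \<Rightarrow> real \<Rightarrow> real fps" where
  "frakS_fps b s x =
     fps_const (2 ^ b * x ^ (b * s)) * (fps_const (1 / 2) * fps_X) ^ (b * s) * fps_exp (1 - x)
       * fps_const (1 / fact (b * s))"

definition frakS :: "nat \<Rightarrow> nat \<Rightarrow> nat \<Rightarrow> real \<Rightarrow> real" where
  "frakS n b s x = fact n * fps_nth (frakS_fps b s x) n"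

text \<open>
  Numerator and denominator both have subdegree \<open>v\<close>, so the division of formal power series
  over a field is the exact quotient.
\<close>

definition bernoulli_higher_fps :: "nat \<Rightarrow> real \<Rightarrow> real fps" where
  "bernoulli_higher_fps v x = fps_X ^ v * fps_exp x / (fps_exp 1 - 1) ^ v"

definition bernoulli_higher :: "nat \<Rightarrow> nat \<Rightarrow> real \<Rightarrow> real" where
  "bernoulli_higher v n x = fact n * fps_nth (bernoulli_higher_fps v x) n"

definition fps_complex :: "real fps \<Rightarrow> complex fps" where
  "fps_complex F = Abs_fps (\<lambda>n. complex_of_real (fps_nth F n))"

lemma fps_complex_nth [simp]: "fps_nth (fps_complex F) n = of_real (fps_nth F n)"
  by (simp add: fps_complex_def)

lemma fps_complex_mult [simp]: "fps_complex (F * G) = fps_complex F * fps_complex G"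
  by (simp add: fps_eq_iff fps_mult_nth)

lemma fps_complex_1 [simp]: "fps_complex 1 = 1"
  by (simp add: fps_eq_iff)

lemma fps_complex_power [simp]: "fps_complex (F ^ n) = fps_complex F ^ n"
  by (induction n) auto

lemma fps_complex_diff [simp]: "fps_complex (F - G) = fps_complex F - fps_complex G"
  by (simp add: fps_eq_iff)

lemma fps_complex_const [simp]: "fps_complex (fps_const c) = fps_const (of_real c)"
  by (simp add: fps_eq_iff)

lemma fps_complex_X [simp]: "fps_complex fps_X = fps_X"
  by (simp add: fps_eq_iff fps_X_def)

lemma fps_complex_exp [simp]: "fps_complex (fps_exp c) = fps_exp (of_real c)"
  by (simp add: fps_eq_iff)

lemma frakS_sums:
  fixes t :: complex
  shows "(\<lambda>n. of_real (frakS n b s x) * t ^ n / fact n) sums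
           (2 ^ b * of_real x ^ (b * s) * (t / 2) ^ (b * s) * exp (t * (1 - of_real x))
             / fact (b * s))"
proof -
  let ?f = "\<lambda>t::complex. (2 ^ b * of_real x ^ (b * s)) * ((1/2) * t) ^ (b * s)
              * exp ((1 - of_real x) * t) * (1 / fact (b * s))"
  have F: "fps_complex (frakS_fps b s x) =
      fps_const (2 ^ b * of_real x ^ (b * s)) * (fps_const (1/2) * fps_X) ^ (b * s)
        * fps_exp (1 - of_real x) * fps_const (1 / fact (b * s))"
    by (simp add: frakS_fps_def)
  have "?f has_fps_expansion fps_complex (frakS_fps b s x)"
    unfolding F by (intro fps_expansion_intros)
  moreover have "?f holomorphic_on eball 0 \<infinity>"
    by (intro holomorphic_intros)
  ultimately have "(\<lambda>n. fps_nth (fps_complex (frakS_fps b s x)) n * t ^ n) sums ?f t"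
    by (rule has_fps_expansion_imp_sums_complex) auto
  thus ?thesis
    by (simp add: frakS_def field_simps)
qed

lemma fps_exp_minus_1_nz: "fps_exp (1::'a::field_char_0) - 1 \<noteq> 0"
  by simp

lemma subdegree_fps_exp_minus_1: "subdegree (fps_exp (1::'a::field_char_0) - 1) = 1"
  by (rule subdegreeI) auto

lemma bernoulli_higher_fps_mult:
  "bernoulli_higher_fps v x * (fps_exp 1 - 1) ^ v = fps_X ^ v * fps_exp x"
proof -
  have "subdegree ((fps_exp (1::real) - 1) ^ v) \<le> subdegree (fps_X ^ v * fps_exp x)"
    unfolding subdegree_power subdegree_fps_exp_minus_1 by simp
  thus ?thesis
    unfolding bernoulli_higher_fps_def
    by (metis dvd_div_mult_self fps_dvd_iff fps_exp_minus_1_nz power_not_zero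
          fps_exp_neq_0 fps_X_neq_zero mult_eq_0_iff)
qed

lemma bernoulli_higher_sums:
  fixes t :: complex
  assumes "norm t < 2 * pi" "t \<noteq> 0"
  shows "(\<lambda>n. of_real (bernoulli_higher v n x) * t ^ n / fact n) sums
           (t ^ v * exp (of_real x * t) / (exp t - 1) ^ v)"
proof -
  define E :: "complex fps" where "E = fps_exp 1 - 1"
  define h :: "complex \<Rightarrow> complex" where "h = (\<lambda>z. if z = 0 then 1 else z / (exp z - 1))"
  have E_nz: "E \<noteq> 0" and E_sub: "subdegree E = 1"
    unfolding E_def by (rule fps_exp_minus_1_nz subdegree_fps_exp_minus_1)+
  have E_nth: "fps_nth E (Suc 0) = 1"
    by (simp add: E_def)
  have "(\<lambda>z::complex. exp (1 * z) - 1) has_fps_expansion E"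
    unfolding E_def by (intro fps_expansion_intros)
  hence E_exp: "(\<lambda>z::complex. exp z - 1) has_fps_expansion E" by simp
  have hE: "h has_fps_expansion fps_X / E"
    unfolding h_def
    by (rule has_fps_expansion_divide[OF _ E_exp])
       (use E_nz E_sub in \<open>auto intro: fps_expansion_intros simp: E_nth\<close>)
  have XE: "(fps_X / E) * E = fps_X"
    using E_nz E_sub by (intro dvd_div_mult_self) (simp add: fps_dvd_iff)
  have "fps_complex (bernoulli_higher_fps v x) * E ^ v = fps_X ^ v * fps_exp (of_real x)"
    using arg_cong[OF bernoulli_higher_fps_mult[of v x], of fps_complex] by (simp add: E_def)
  also have "\<dots> = ((fps_X / E) ^ v * fps_exp (of_real x)) * E ^ v"
    by (metis (no_types, lifting) XE mult.assoc mult.commute power_mult_distrib)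
  finally have B: "fps_complex (bernoulli_higher_fps v x) =
      (fps_X / E) ^ v * fps_exp (of_real x)"
    using E_nz by simp
  have expansion: "(\<lambda>z. h z ^ v * exp (of_real x * z)) has_fps_expansion
      fps_complex (bernoulli_higher_fps v x)"
    unfolding B by (intro fps_expansion_intros hE)
  have exp_ne: "exp z \<noteq> 1" if "norm z < 2 * pi" "z \<noteq> 0" for z :: complex
  proof
    assume "exp z = 1"
    then obtain n :: int where n: "Re z = 0" "Im z = of_int (2 * n) * pi"
      by (auto simp: exp_eq_1)
    with that(2) have "n \<noteq> 0" by (auto simp: complex_eq_iff)
    hence "1 \<le> \<bar>real_of_int n\<bar>" by linarith
    hence "2 * pi \<le> \<bar>Im z\<bar>" by (simp add: n abs_mult)
    also have "\<dots> \<le> norm z" by (rule abs_Im_le_cmod)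
    finally show False using that by simp
  qed
  have "h holomorphic_on ball 0 (2 * pi)"
  proof (rule no_isolated_singularity)
    show "continuous_on (ball 0 (2 * pi)) h"
    proof (intro continuous_at_imp_continuous_on ballI)
      fix z :: complex assume z: "z \<in> ball 0 (2 * pi)"
      show "isCont h z"
      proof (cases "z = 0")
        case True
        thus ?thesis using has_fps_expansion_imp_continuous[OF hE] by simp
      next
        case False
        have "isCont (\<lambda>z. z / (exp z - 1)) z"
          using exp_ne[of z] z False by (intro continuous_intros) auto
        moreover have "eventually (\<lambda>w. h w = w / (exp w - 1)) (nhds z)"
          using t1_space_nhds[OF False] by eventually_elim (auto simp: h_def)
        ultimately show ?thesis by (simp add: isCont_cong)
      qed
    qed
    have "(\<lambda>z::complex. z / (exp z - 1)) holomorphic_on ball 0 (2 * pi) - {0}"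
      using exp_ne by (intro holomorphic_intros) auto
    thus "h holomorphic_on ball 0 (2 * pi) - {0}"
      by (rule holomorphic_transform) (auto simp: h_def)
  qed auto
  hence "(\<lambda>z. h z ^ v * exp (of_real x * z)) holomorphic_on eball 0 (ereal (2 * pi))"
    by (auto intro!: holomorphic_intros)
  from has_fps_expansion_imp_sums_complex[OF expansion this, of t] assms
  have "(\<lambda>n. fps_nth (fps_complex (bernoulli_higher_fps v x)) n * t ^ n) sums
      (h t ^ v * exp (of_real x * t))" by simp
  thus ?thesis
    using assms(2) by (simp add: bernoulli_higher_def h_def power_divide)
qed

lemma Stirling_fps_nth:
  "fps_nth (fps_const (1 / fact v) * (fps_exp 1 - 1) ^ v :: 'a::field_char_0 fps) n
     = of_nat (Stirling n v) / fact n"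
proof -
  define G :: "nat \<Rightarrow> 'a fps" where "G = (\<lambda>v. fps_const (1 / fact v) * (fps_exp 1 - 1) ^ v)"
  have deriv: "fps_deriv (G (Suc v)) = of_nat (Suc v) * G (Suc v) + G v" for v
  proof -
    have c: "fps_const (1 / fact (Suc v)) * of_nat (Suc v) = (fps_const (1 / fact v) :: 'a fps)"
      by (simp add: fps_of_nat[symmetric] del: of_nat_Suc)
    have D: "fps_deriv ((fps_exp 1 - 1) ^ Suc v) =
        of_nat (Suc v) * ((fps_exp 1 - 1) ^ v * fps_exp (1::'a))"
      by (subst fps_deriv_power)
         (simp add: fps_of_nat mult_ac del: of_nat_Suc power_Suc)
    have "fps_deriv (G (Suc v)) =
        (fps_const (1 / fact (Suc v)) * of_nat (Suc v)) * ((fps_exp 1 - 1) ^ v * fps_exp 1)"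
      by (simp add: G_def D mult.assoc del: of_nat_Suc fact_Suc power_Suc)
    also have "\<dots> = (fps_const (1 / fact (Suc v)) * of_nat (Suc v)) *
        ((fps_exp 1 - 1) ^ Suc v + (fps_exp 1 - 1) ^ v)"
      by (simp add: algebra_simps)
    also have "\<dots> = of_nat (Suc v) * G (Suc v)
        + (fps_const (1 / fact (Suc v)) * of_nat (Suc v)) * (fps_exp 1 - 1) ^ v"
      by (simp only: G_def algebra_simps)
    finally show ?thesis by (simp only: c) (simp add: G_def)
  qed
  have "fps_nth (G v) n = of_nat (Stirling n v) / fact n" for n v
  proof (induction n v rule: Stirling.induct)
    case (4 n k)
    have "of_nat (Suc n) * fps_nth (G (Suc k)) (Suc n) = fps_nth (fps_deriv (G (Suc k))) n"
      by simp
    also have "\<dots> = of_nat (Suc k) * fps_nth (G (Suc k)) n + fps_nth (G k) n"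
      by (simp add: deriv fps_of_nat[symmetric] del: of_nat_Suc fps_deriv_nth)
    also have "\<dots> = of_nat (Stirling (Suc n) (Suc k)) / fact n"
      by (simp add: 4 field_simps)
    finally show ?case
      by (simp add: field_simps del: of_nat_Suc Stirling.simps)
  qed (simp_all add: G_def)
  thus ?thesis by (simp add: G_def)
qed

lemma Stirling_sums:
  fixes t :: complex
  shows "(\<lambda>n. of_nat (Stirling n v) * t ^ n / fact n) sums
           ((-1) ^ v * (1 - exp t) ^ v / fact v)"
proof -
  let ?f = "\<lambda>t::complex. (1 / fact v) * (exp (1 * t) - 1) ^ v"
  have "?f has_fps_expansion fps_const (1 / fact v) * (fps_exp 1 - 1) ^ v"
    by (intro fps_expansion_intros)
  moreover have "?f holomorphic_on eball 0 \<infinity>"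
    by (intro holomorphic_intros)
  ultimately have "(\<lambda>n. fps_nth (fps_const (1 / fact v) * (fps_exp 1 - 1) ^ v) n * t ^ n) sums ?f t"
    by (rule has_fps_expansion_imp_sums_complex) auto
  moreover have "?f t = (-1) ^ v * (1 - exp t) ^ v / fact v"
    by (simp flip: power_mult_distrib)
  ultimately show ?thesis
    by (simp only: Stirling_fps_nth) simp
qed

end

theory Submission
  imports Defs
begin

text \<open>
  The factor \<open>(e\<^sup>t - 1)\<^sup>v\<close> is the numerator of the generating function of the Stirling numbers
  and the denominator of that of the Bernoulli polynomials of order \<open>v\<close>. It cancels in their
  product, which is therefore \<open>t\<^sup>v e\<^bsup>yt\<^esup> / v!\<close>. For \<open>v = b s\<close> and \<open>y = 1 - x\<close> this is, up to the
  constant \<open>2\<^bsup>b - bs\<^esup> x\<^bsup>bs\<^esup>\<close>, the generating function of \<open>frakS\<close>. Comparing coefficients of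
  exponential generating functions turns the product into a binomial convolution.
\<close>

text \<open>
  The exact division behind the Bernoulli polynomials makes the cancellation valid although
  \<open>e\<^sup>t - 1\<close> is not invertible as a power series.
\<close>

lemma Stirling_bernoulli_convolution:
  "(\<Sum>j=0..n. real (n choose j) * real (Stirling j v) * bernoulli_higher v (n - j) y)
     = fact n * fps_nth (fps_const (1 / fact v) * (fps_X ^ v * fps_exp y)) n"
proof -
  define G :: "real fps" where "G = fps_const (1 / fact v) * (fps_exp 1 - 1) ^ v"
  have "G * bernoulli_higher_fps v y
      = fps_const (1 / fact v) * (bernoulli_higher_fps v y * (fps_exp 1 - 1) ^ v)"
    by (simp add: G_def mult_ac)
  also have "\<dots> = fps_const (1 / fact v) * (fps_X ^ v * fps_exp y)"
    by (simp only: bernoulli_higher_fps_mult)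
  finally have "fact n * fps_nth (fps_const (1 / fact v) * (fps_X ^ v * fps_exp y)) n
      = (\<Sum>j=0..n. fact n * (fps_nth G j * fps_nth (bernoulli_higher_fps v y) (n - j)))"
    by (metis fps_mult_nth sum_distrib_left)
  also have "\<dots> = (\<Sum>j=0..n. real (n choose j) * real (Stirling j v) *
      bernoulli_higher v (n - j) y)"
    by (rule sum.cong)
       (auto simp: G_def Stirling_fps_nth bernoulli_higher_def binomial_fact field_simps
             simp del: fps_mult_left_const_nth)
  finally show ?thesis ..
qed

lemma frakS_fps_eq:
  "frakS_fps b s x = fps_const (2 powi (int b * (1 - int s)) * x ^ (b * s)) *
     (fps_const (1 / fact (b * s)) * (fps_X ^ (b * s) * fps_exp (1 - x)))"
proof -
  have "(2::real) powi (int b * (1 - int s)) = 2 powi (int b - int (b * s))"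
    by (simp add: algebra_simps)
  also have "\<dots> = 2 ^ b * (1 / 2) ^ (b * s)"
    by (simp add: power_int_diff power_one_over field_simps del: of_nat_mult)
  finally have "fps_const (2 powi (int b * (1 - int s)) * x ^ (b * s))
      = fps_const (2 ^ b * x ^ (b * s)) * fps_const (1 / 2) ^ (b * s)"
    by (simp add: fps_const_power mult_ac)
  thus ?thesis
    unfolding frakS_fps_def by (simp only: power_mult_distrib mult_ac)
qed

theorem theorem5:
  fixes x :: real and b n s :: nat
  assumes "x \<in> {0..1}" and "n \<ge> b * s"
  shows "frakS n b s x =
    2 powi (int b * (1 - int s)) * x ^ (b * s) *
    (\<Sum>j=0..n. real (n choose j) * real (Stirling j (b * s)) *
       bernoulli_higher (b * s) (n - j) (1 - x))"
  unfolding Stirling_bernoulli_convolution frakS_def frakS_fps_eq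
  by (subst fps_mult_left_const_nth) (simp only: mult_ac)

end
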